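(* Let $\mathsf{M}$ be a locally compact Hausdorff space and let $\Sigma=(\mathsf{M},\varphi,\mathbb{R}_{\geq 0})$ be a (global, continuous) semi-dynamical system on $\mathsf{M}$ whose set of start points is empty. Let $A\subseteq \mathsf{M}$ be a compact, invariant, (local) asymptotically stable attractor under $\Sigma$ with domain of attraction $\mathcal{D}_{\Sigma}(A)$. Then $A$ is a strong deformation retract of $\mathcal{D}_{\Sigma}(A)$ if and only if the inclusion $\iota_A:A\hookrightarrow \mathcal{D}_{\Sigma}(A)$ is a cofibration.
   Context: A semi-dynamical system $\Sigma=(\mathsf{M},\varphi,\mathbb{R}_{\geq 0})$ consists of a locally compact Hausdorff space $\mathsf{M}$ and a continuous map (semi-flow) $\varphi:\mathbb{R}_{\geq 0}\times \mathsf{M}\to \mathsf{M}$ such that for all $x\in\mathsf{M}$: $\varphi(0,x)=x$, and $\varphi(s,\varphi(t,x))=\varphi(t+s,x)$ for all $s,t\geq 0$. Write $\varphi^t=\varphi(t,\cdot)$. Locally compact means that every point $x$ has a compact set containing an open neighbourhood of $x$. A point $x\in \mathsf{M}$ is a start point under $\Sigma$ if $\varphi^t(y)\neq x$ for all $(t,y)\in \mathbb{R}_{>0}\times \mathsf{M}$. A compact set $A\subseteq \mathsf{M}$ is an invariant, (local) asymptotically stable attractor under $\Sigma$ if: (i) (invariance, in both time directions) $\varphi(\mathbb{R},A)=A$, where for $t<0$ the set $\varphi(t,A)$ denotes the preimage $\{y\in\mathsf{M}:\varphi(-t,y)\in A\}$; that is, for every $t\geq 0$ both $\varphi^t(A)\subseteq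 A$ and $(\varphi^t)^{-1}(A)\subseteq A$; (ii) (Lyapunov stability) for any open neighbourhood $U_\varepsilon\subseteq\mathsf{M}$ of $A$ there is an open neighbourhood $U_\delta\subseteq U_\varepsilon$ of $A$ with $\varphi(\mathbb{R}_{\geq 0},U_\delta)\subseteq U_\varepsilon$; and (local attractivity) there is an open neighbourhood $W\subseteq \mathsf{M}$ of $A$ such that for any $p\in W$ and any open neighbourhood $V\subseteq \mathsf{M}$ of $A$ there is $T\geq 0$ with $\varphi^t(p)\in V$ for all $t\geq T$. The domain of attraction of $A$ is $\mathcal{D}_{\Sigma}(A)=\{p\in \mathsf{M}:$ for any open neighbourhood $U\subseteq \mathsf{M}$ of $A$ there is $T\geq 0$ such that $\varphi^t(p)\in U$ for all $t\geq T\}$, with the subspace topology. A subset $A\subseteq X$ is a strong deformation retract of $X$ if there is a continuous map $H:X\times[0,1]\to X$ with $H(x,0)=x$ and $H(x,1)\in A$ for all $x\in X$, and $H(a,s)=a$ for all $a\in A$, $s\in[0,1]$. A continuous map $i:A\to X$ is a cofibration (in the Hurewicz sense) if it has the homotopy extension property: for every topological space $Y$, every continuous $g:X\to Y$ and every continuous $h:A\times[0,1]\to Y$ with $h(a,0)=g(i(a))$ for all $a\in A$, there is a continuous $\widetilde h:X\times[0,1]\to Y$ with $\widetilde h(x,0)=g(x)$ for all $x\in X$ and $\widetilde h(i(a),s)=h(a,s)$ for all $a\in A$, $s\in[0,1]$. *)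

theory Defs
  imports "HOL-Analysis.Analysis"
begin

section \<open>Semi-dynamical systems\<close>

text \<open>Only the values of the semi-flow at times \<open>t \<ge> 0\<close> and at points of the carrier of the space
  matter; the underlying HOL function is total.\<close>

definition semi_dynamical_system :: "'a topology \<Rightarrow> (real \<Rightarrow> 'a \<Rightarrow> 'a) \<Rightarrow> bool" where
  "semi_dynamical_system M \<phi> \<longleftrightarrow>
     locally_compact_space M \<and> Hausdorff_space M \<and>
     continuous_map (prod_topology (top_of_set {0..}) M) M (\<lambda>(t, x). \<phi> t x) \<and>
     (\<forall>x \<in> topspace M. \<phi> 0 x = x) \<and>
     (\<forall>x \<in> topspace M. \<forall>s \<ge> 0. \<forall>t \<ge> 0. \<phi> s (\<phi> t x) = \<phi> (t + s) x)"

definition start_points :: "'a topology \<Rightarrow> (real \<Rightarrow> 'a \<Rightarrow> 'a) \<Rightarrow> 'a set" where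
  "start_points M \<phi> = {x \<in> topspace M. \<forall>t > 0. \<forall>y \<in> topspace M. \<phi> t y \<noteq> x}"

definition flow_set :: "'a topology \<Rightarrow> (real \<Rightarrow> 'a \<Rightarrow> 'a) \<Rightarrow> real \<Rightarrow> 'a set \<Rightarrow> 'a set" where
  "flow_set M \<phi> t A = (if t \<ge> 0 then \<phi> t ` A else {y \<in> topspace M. \<phi> (- t) y \<in> A})"

definition invariant_set :: "'a topology \<Rightarrow> (real \<Rightarrow> 'a \<Rightarrow> 'a) \<Rightarrow> 'a set \<Rightarrow> bool" where
  "invariant_set M \<phi> A \<longleftrightarrow> (\<Union>t. flow_set M \<phi> t A) = A"

definition lyapunov_stable :: "'a topology \<Rightarrow> (real \<Rightarrow> 'a \<Rightarrow> 'a) \<Rightarrow> 'a set \<Rightarrow> bool" where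
  "lyapunov_stable M \<phi> A \<longleftrightarrow>
     (\<forall>U. openin M U \<and> A \<subseteq> U \<longrightarrow>
        (\<exists>V. openin M V \<and> A \<subseteq> V \<and> V \<subseteq> U \<and> (\<Union>t\<in>{0..}. \<phi> t ` V) \<subseteq> U))"

definition locally_attractive :: "'a topology \<Rightarrow> (real \<Rightarrow> 'a \<Rightarrow> 'a) \<Rightarrow> 'a set \<Rightarrow> bool" where
  "locally_attractive M \<phi> A \<longleftrightarrow>
     (\<exists>W. openin M W \<and> A \<subseteq> W \<and>
        (\<forall>p \<in> W. \<forall>V. openin M V \<and> A \<subseteq> V \<longrightarrow> (\<exists>T \<ge> 0. \<forall>t \<ge> T. \<phi> t p \<in> V)))"

definition invariant_attractor :: "'a topology \<Rightarrow> (real \<Rightarrow> 'a \<Rightarrow> 'a) \<Rightarrow> 'a set \<Rightarrow> bool" where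
  "invariant_attractor M \<phi> A \<longleftrightarrow>
     compactin M A \<and> invariant_set M \<phi> A \<and> lyapunov_stable M \<phi> A \<and> locally_attractive M \<phi> A"

definition domain_of_attraction :: "'a topology \<Rightarrow> (real \<Rightarrow> 'a \<Rightarrow> 'a) \<Rightarrow> 'a set \<Rightarrow> 'a set" where
  "domain_of_attraction M \<phi> A =
     {p \<in> topspace M. \<forall>U. openin M U \<and> A \<subseteq> U \<longrightarrow> (\<exists>T \<ge> 0. \<forall>t \<ge> T. \<phi> t p \<in> U)}"

lemma invariant_set_iff:
  assumes "semi_dynamical_system M \<phi>" and A: "A \<subseteq> topspace M"
  shows "invariant_set M \<phi> A \<longleftrightarrow>
     (\<forall>t \<ge> 0. \<phi> t ` A \<subseteq> A \<and> {y \<in> topspace M. \<phi> t y \<in> A} \<subseteq> A)"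
proof -
  have id0: "\<phi> 0 x = x" if "x \<in> topspace M" for x
    using assms(1) that by (auto simp: semi_dynamical_system_def)
  have "A \<subseteq> flow_set M \<phi> 0 A"
    using A id0 by (force simp: flow_set_def)
  then have "invariant_set M \<phi> A \<longleftrightarrow> (\<forall>t. flow_set M \<phi> t A \<subseteq> A)"
    by (auto simp: invariant_set_def)
  also have "\<dots> \<longleftrightarrow> (\<forall>t \<ge> 0. \<phi> t ` A \<subseteq> A \<and> {y \<in> topspace M. \<phi> t y \<in> A} \<subseteq> A)"
  proof (intro iffI allI impI)
    fix t :: real
    assume *: "\<forall>t. flow_set M \<phi> t A \<subseteq> A" and "t \<ge> 0"
    then show "\<phi> t ` A \<subseteq> A \<and> {y \<in> topspace M. \<phi> t y \<in> A} \<subseteq> A"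
      using *[rule_format, of t] *[rule_format, of "- t"] id0
      by (cases "t = 0") (auto simp: flow_set_def)
  next
    fix t :: real
    assume *: "\<forall>t \<ge> 0. \<phi> t ` A \<subseteq> A \<and> {y \<in> topspace M. \<phi> t y \<in> A} \<subseteq> A"
    show "flow_set M \<phi> t A \<subseteq> A"
      using *[rule_format, of t] *[rule_format, of "- t"] by (auto simp: flow_set_def)
  qed
  finally show ?thesis .
qed

section \<open>Strong deformation retracts and cofibrations\<close>

definition strong_deformation_retract_of_space :: "'a set \<Rightarrow> 'a topology \<Rightarrow> bool"
    (infix \<open>strong'_deformation'_retract'_of'_space\<close> 50) where
  "A strong_deformation_retract_of_space X \<longleftrightarrow>
     A \<subseteq> topspace X \<and>
     (\<exists>H. continuous_map (prod_topology X (top_of_set {0..1::real})) X H \<and>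
        (\<forall>x \<in> topspace X. H (x, 0) = x \<and> H (x, 1) \<in> A) \<and>
        (\<forall>a \<in> A. \<forall>s \<in> {0..1}. H (a, s) = a))"

definition homotopy_extension_into ::
    "'a topology \<Rightarrow> 'b topology \<Rightarrow> ('a \<Rightarrow> 'b) \<Rightarrow> 'c topology \<Rightarrow> bool" where
  "homotopy_extension_into A X i Y \<longleftrightarrow>
     (\<forall>g h. continuous_map X Y g \<and>
        continuous_map (prod_topology A (top_of_set {0..1::real})) Y h \<and>
        (\<forall>a \<in> topspace A. h (a, 0) = g (i a)) \<longrightarrow>
        (\<exists>h'. continuous_map (prod_topology X (top_of_set {0..1::real})) Y h' \<and>
           (\<forall>x \<in> topspace X. h' (x, 0) = g x) \<and>
           (\<forall>a \<in> topspace A. \<forall>s \<in> {0..1}. h' (i a, s) = h (a, s))))"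

text \<open>A definition in HOL cannot quantify over all types, so the target spaces \<open>Y\<close> range over all
  topologies on the type \<open>'b + 'a \<times> real\<close>. This type is large enough to carry the mapping
  cylinder of \<open>i\<close>, so nothing is lost: \<open>cofibration_homotopy_extension\<close> below derives the homotopy
  extension property for target spaces over an arbitrary type.\<close>

definition cofibration :: "'a topology \<Rightarrow> 'b topology \<Rightarrow> ('a \<Rightarrow> 'b) \<Rightarrow> bool" where
  "cofibration A X i \<longleftrightarrow>
     continuous_map A X i \<and>
     (\<forall>Y :: ('b + 'a \<times> real) topology. homotopy_extension_into A X i Y)"

lemma cofibration_homotopy_extension:
  fixes A :: "'a topology" and X :: "'b topology" and Y :: "'c topology"
  assumes "cofibration A X i"
  shows "homotopy_extension_into A X i Y"
proof -
  let ?AI = "prod_topology A (top_of_set {0..1::real})"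
  let ?XI = "prod_topology X (top_of_set {0..1::real})"
  define j :: "'a \<times> real \<Rightarrow> 'b + 'a \<times> real"
    where "j = (\<lambda>(a, s). if s = 0 then Inl (i a) else Inr (a, s))"
  define P where "P = Inl ` topspace X \<union> j ` topspace ?AI"
  define opn where "opn = (\<lambda>U. U \<subseteq> P \<and> openin X {x \<in> topspace X. Inl x \<in> U} \<and>
    openin ?AI {z \<in> topspace ?AI. j z \<in> U})"
  define C where "C = topology opn"
  have ist: "istopology opn"
    unfolding istopology_def
  proof (intro conjI allI impI)
    fix S T assume S: "opn S" and T: "opn T"
    have "{x \<in> topspace X. Inl x \<in> S \<inter> T} =
        {x \<in> topspace X. Inl x \<in> S} \<inter> {x \<in> topspace X. Inl x \<in> T}"
      and "{z \<in> topspace ?AI. j z \<in> S \<inter> T} =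
        {z \<in> topspace ?AI. j z \<in> S} \<inter> {z \<in> topspace ?AI. j z \<in> T}"
      by auto
    with S T show "opn (S \<inter> T)"
      unfolding opn_def by (metis (no_types, lifting) le_infI1 openin_Int)
  next
    fix \<K> assume K: "\<forall>K\<in>\<K>. opn K"
    have "{x \<in> topspace X. Inl x \<in> \<Union>\<K>} = (\<Union>K\<in>\<K>. {x \<in> topspace X. Inl x \<in> K})"
      and "{z \<in> topspace ?AI. j z \<in> \<Union>\<K>} = (\<Union>K\<in>\<K>. {z \<in> topspace ?AI. j z \<in> K})"
      by auto
    moreover have "openin X (\<Union>K\<in>\<K>. {x \<in> topspace X. Inl x \<in> K})"
      and "openin ?AI (\<Union>K\<in>\<K>. {z \<in> topspace ?AI. j z \<in> K})"
      using K by (auto simp: opn_def simp del: topspace_prod_topology)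
    ultimately show "opn (\<Union>\<K>)"
      using K unfolding opn_def by (simp add: Sup_le_iff)
  qed
  have opC: "openin C U \<longleftrightarrow> opn U" for U
    using ist by (simp add: C_def topology_inverse')
  have iX: "i a \<in> topspace X" if "a \<in> topspace A" for a
    using assms that by (auto simp: cofibration_def continuous_map_def)
  have "{x \<in> topspace X. Inl x \<in> P} = topspace X"
    and "{z \<in> topspace ?AI. j z \<in> P} = topspace ?AI"
    by (auto simp: P_def)
  then have "opn P"
    unfolding opn_def by (metis (no_types, lifting) openin_topspace subset_refl)
  then have tC: "topspace C = P"
    unfolding topspace_def opC by (auto simp: opn_def)
  have cInl: "continuous_map X C Inl"
    unfolding continuous_map_def tC opC by (auto simp: opn_def P_def)
  have cj: "continuous_map ?AI C j"
    unfolding continuous_map_def tC opC opn_def P_def by blast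
  have "homotopy_extension_into A X i C"
    using assms by (simp add: cofibration_def)
  note hep = this[unfolded homotopy_extension_into_def, THEN spec, THEN spec, THEN mp, of Inl j]
  have "\<forall>a \<in> topspace A. j (a, 0) = Inl (i a)"
    by (simp add: j_def)
  from hep[OF conjI[OF cInl conjI[OF cj this]]] obtain r
    where r: "continuous_map ?XI C r"
      and r0: "\<forall>x \<in> topspace X. r (x, 0) = Inl x"
      and rj: "\<forall>a \<in> topspace A. \<forall>s \<in> {0..1}. r (i a, s) = j (a, s)"
    by (elim exE conjE)
  show ?thesis
    unfolding homotopy_extension_into_def
  proof (intro allI impI, elim conjE)
    fix g h
    assume g: "continuous_map X Y g" and h: "continuous_map ?AI Y h"
      and gh: "\<forall>a \<in> topspace A. h (a, 0) = g (i a)"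
    define k where "k = case_sum g h"
    have kj: "k (j z) = h z" if "z \<in> topspace ?AI" for z
      using that gh by (auto simp: k_def j_def)
    have k: "continuous_map C Y k"
      unfolding continuous_map_def tC opC
    proof (intro conjI allI impI)
      show "k \<in> P \<rightarrow> topspace Y"
        using g h kj by (auto simp: P_def k_def continuous_map_def Pi_iff)
      fix U assume U: "openin Y U"
      have "{x \<in> topspace X. Inl x \<in> {y \<in> P. k y \<in> U}} = {x \<in> topspace X. g x \<in> U}"
        by (auto simp: P_def k_def)
      moreover have "{z \<in> topspace ?AI. j z \<in> {y \<in> P. k y \<in> U}} = {z \<in> topspace ?AI. h z \<in> U}"
      proof (rule Collect_cong)
        fix z
        have "j z \<in> P" if "z \<in> topspace ?AI"
          unfolding P_def using that by (intro UnI2 imageI)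
        then show "z \<in> topspace ?AI \<and> j z \<in> {y \<in> P. k y \<in> U} \<longleftrightarrow>
            z \<in> topspace ?AI \<and> h z \<in> U"
          using kj[of z] by (auto simp del: topspace_prod_topology)
      qed
      ultimately show "opn {y \<in> P. k y \<in> U}"
        unfolding opn_def
        using openin_continuous_map_preimage[OF g U] openin_continuous_map_preimage[OF h U]
        by (simp only:) blast
    qed
    show "\<exists>h'. continuous_map ?XI Y h' \<and> (\<forall>x \<in> topspace X. h' (x, 0) = g x) \<and>
        (\<forall>a \<in> topspace A. \<forall>s \<in> {0..1}. h' (i a, s) = h (a, s))"
    proof (intro exI conjI ballI)
      show "continuous_map ?XI Y (k \<circ> r)"
        using r k by (rule continuous_map_compose)
      show "(k \<circ> r) (x, 0) = g x" if "x \<in> topspace X" for x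
        using that r0 by (simp add: k_def)
      show "(k \<circ> r) (i a, s) = h (a, s)" if "a \<in> topspace A" "s \<in> {0..1}" for a s
        using that rj kj[of "(a, s)"] by simp
    qed
  qed
qed

end

(* If the inclusion is a cofibration, a retraction of X x [0,1] onto X x {0} \<union> A x [0,1] deforms some
   neighbourhood U of A into A, fixing A; the flow carries every point x of the domain of attraction
   X into U within a time depending continuously on x and vanishing on A, so flowing first and
   deforming afterwards retracts X onto A.

   Conversely, A is the zero set of a continuous function w on X: without start points, the images
   under the time-n maps of a compact neighbourhood K of A are again neighbourhoods of A, and by
   uniform attraction they intersect in A. A retraction H run at speed 1/w then extends
   homotopies: follow g o H up to time w(x), and afterwards the given homotopy at H(x,1). *)

theory Submission
  imports Defs
begin

section \<open>Topological preliminaries\<close>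

lemma continuous_map_compose_pair:
  assumes "continuous_map (prod_topology X Y) Z h"
    and "continuous_map W X f" and "continuous_map W Y g"
  shows "continuous_map W Z (\<lambda>w. h (f w, g w))"
  using continuous_map_compose[OF continuous_map_pairedI[OF assms(2,3)] assms(1)]
  by (simp add: o_def)

text \<open>A form of the tube lemma: the complement is the projection of a closed set along the
  compact factor, and that projection is a closed map.\<close>

lemma openin_forall_compact_space:
  assumes "compact_space Y" and W: "openin (prod_topology X Y) W"
  shows "openin X {x \<in> topspace X. \<forall>y \<in> topspace Y. (x, y) \<in> W}"
proof -
  have "closedin X (fst ` (topspace (prod_topology X Y) - W))"
    using closed_map_fst[OF assms(1), of X] W unfolding closed_map_def by blast
  moreover have "{x \<in> topspace X. \<forall>y \<in> topspace Y. (x, y) \<in> W} =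
      topspace X - fst ` (topspace (prod_topology X Y) - W)"
    by force
  ultimately show ?thesis
    by (metis openin_diff openin_topspace)
qed

text \<open>Each \<open>N n\<close> contributes a Urysohn function that is 0 on \<open>A\<close> and
  1 off \<open>N n\<close>. In a weighted sum of nonnegative terms nothing cancels, so the sum
  vanishes only at points of every \<open>N n\<close>.\<close>

lemma zero_set_Inter_neighbourhoods:
  assumes X: "completely_regular_space X" and A: "compactin X A"
    and O: "\<And>n::nat. openin X (N n)" "\<And>n. A \<subseteq> N n" and N: "(\<Inter>n. N n) \<subseteq> A"
  obtains w where "continuous_map X euclideanreal w"
    and "\<And>x. x \<in> topspace X \<Longrightarrow> 0 \<le> w x" and "\<And>x. x \<in> topspace X \<Longrightarrow> w x = 0 \<longleftrightarrow> x \<in> A"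
proof -
  have "\<exists>f. continuous_map X (top_of_set {0..1::real}) f \<and> f ` A \<subseteq> {0} \<and>
      f ` (topspace X - N n) \<subseteq> {1}" for n
  proof -
    have "closedin X (topspace X - N n)" "disjnt (topspace X - N n) A"
      using O by (auto simp: disjnt_def)
    then show ?thesis
      by (rule Urysohn_completely_regular_closed_compact[OF zero_le_one X _ A]) blast
  qed
  then obtain f where f: "\<And>n. continuous_map X (top_of_set {0..1::real}) (f n)"
    and fA: "\<And>n. f n ` A \<subseteq> {0}" and fN: "\<And>n. f n ` (topspace X - N n) \<subseteq> {1}"
    by metis
  have f01: "0 \<le> f n x" "f n x \<le> 1" if "x \<in> topspace X" for n x
    using f[of n] that by (auto simp: continuous_map_def Pi_iff)
  define w where "w x = (\<Sum>n. (1/2)^n * f n x)" for x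
  have sm: "summable (\<lambda>n. (1/2)^n * f n x)" if "x \<in> topspace X" for x
    by (rule summable_comparison_test'[of "\<lambda>n. (1/2::real)^n" 0])
      (use f01[OF that] in \<open>auto simp: abs_mult mult_left_le\<close>)
  \<comment> \<open>The weights \<open>(1/2)^n\<close> dominate the terms, so the partial sums
    converge uniformly and \<open>w\<close> inherits their continuity.\<close>
  have "uniform_limit (topspace X) (\<lambda>m x. \<Sum>n<m. (1/2)^n * f n x) w sequentially"
    unfolding w_def
    by (rule Weierstrass_m_test[where M = "\<lambda>n. (1/2::real)^n"])
      (use f01 in \<open>auto simp: abs_mult mult_left_le\<close>)
  then have lim: "\<forall>\<^sub>F m in sequentially. \<forall>x \<in> topspace X. dist (\<Sum>n<m. (1/2)^n * f n x) (w x) < e"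
    if "e > 0" for e
    using that by (simp add: uniform_limit_iff)
  have "continuous_map X euclideanreal (\<lambda>x. \<Sum>n<m. (1/2)^n * f n x)" for m
    by (intro continuous_map_sum continuous_map_real_mult_left
        continuous_map_into_fulltopology[OF f]) simp
  then have "continuous_map X Met_TC.mtopology w"
    by (intro Met_TC.continuous_map_uniform_limit[where F = sequentially
          and f = "\<lambda>m x. \<Sum>n<m. (1/2)^n * f n x"])
      (use lim in simp_all)
  then have "continuous_map X euclideanreal w" by simp
  moreover have "0 \<le> w x" if "x \<in> topspace X" for x
    unfolding w_def using f01[OF that] by (intro suminf_nonneg sm that) auto
  moreover have "w x = 0 \<longleftrightarrow> x \<in> A" if "x \<in> topspace X" for x
  proof -
    have "w x = 0 \<longleftrightarrow> (\<forall>n. f n x = 0)"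
      unfolding w_def using f01[OF that] by (subst suminf_eq_zero_iff) (auto intro: sm that)
    also have "\<dots> \<longleftrightarrow> x \<in> A"
    proof
      assume "\<forall>n. f n x = 0"
      with fN that have "x \<in> N n" for n by fastforce
      with N show "x \<in> A" by blast
    qed (use fA in blast)
    finally show ?thesis .
  qed
  ultimately show thesis by (rule that)
qed

section \<open>Cofibrations and deformations\<close>

text \<open>\<open>H\<close> and \<open>w\<close> amount to an NDR pair. The given homotopy can only
  start once \<open>x\<close> has been moved into \<open>A\<close>, and \<open>w x\<close> is the
  waiting time; it is zero exactly on \<open>A\<close>, where the extension must follow
  \<open>h\<close> from the beginning.\<close>

lemma strong_deformation_retract_imp_cofibration:
  assumes A: "A strong_deformation_retract_of_space X"
    and w: "continuous_map X euclideanreal w"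
    and w0: "\<And>x. x \<in> topspace X \<Longrightarrow> 0 \<le> w x"
    and wA: "\<And>x. x \<in> topspace X \<Longrightarrow> w x = 0 \<longleftrightarrow> x \<in> A"
  shows "cofibration (subtopology X A) X (\<lambda>x. x)"
  unfolding cofibration_def homotopy_extension_into_def
proof (intro conjI allI impI, goal_cases)
  case 1
  show ?case by (simp add: continuous_map_from_subtopology)
next
  case (2 Y g h)
  let ?I = "top_of_set {0..1::real}"
  let ?XI = "prod_topology X ?I"
  let ?Q = "subtopology ?XI {z \<in> topspace ?XI. snd z \<le> w (fst z)}"
  from 2 have g: "continuous_map X Y g"
    and h: "continuous_map (prod_topology (subtopology X A) ?I) Y h"
    and gh: "\<And>a. a \<in> topspace X \<Longrightarrow> a \<in> A \<Longrightarrow> h (a, 0) = g a"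
    by auto
  from A obtain H where AX: "A \<subseteq> topspace X" and H: "continuous_map ?XI X H"
    and H0: "\<And>x. x \<in> topspace X \<Longrightarrow> H (x, 0) = x"
    and H1: "\<And>x. x \<in> topspace X \<Longrightarrow> H (x, 1) \<in> A"
    and HA: "\<And>a s. a \<in> A \<Longrightarrow> s \<in> {0..1} \<Longrightarrow> H (a, s) = a"
    unfolding strong_deformation_retract_of_space_def by blast
  have wf: "continuous_map ?XI euclideanreal (\<lambda>z. w (fst z))"
    using continuous_map_compose[OF continuous_map_fst w] by (simp add: o_def)
  have sn: "continuous_map ?XI euclideanreal snd"
    using continuous_map_into_fulltopology[OF continuous_map_snd] .
  \<comment> \<open>Over \<open>A\<close> the divisor is 0 and so is the quotient by convention,
    hence \<open>P z\<close> is \<open>H (fst z, 0)\<close> there.\<close>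
  define P where "P z = H (fst z, snd z / w (fst z))" for z
  have dv: "s / w x \<in> {0..1}" if "x \<in> topspace X" "s \<in> {0..1}" "s \<le> w x" for x s
    using that w0[of x] by (auto simp: divide_le_eq)
  \<comment> \<open>Near a point of \<open>A \<times> {0}\<close> the quotient is not continuous, but there \<open>H\<close> is close to the
    identity uniformly in its time argument.\<close>
  have P: "continuous_map ?Q X P"
    unfolding continuous_map_def
  proof (intro conjI allI impI)
    show "P \<in> topspace ?Q \<rightarrow> topspace X"
    proof
      fix z assume "z \<in> topspace ?Q"
      then have "(fst z, snd z / w (fst z)) \<in> topspace ?XI"
        using dv[of "fst z" "snd z"] by auto
      then show "P z \<in> topspace X"
        using H unfolding P_def continuous_map_def by blast
    qed
    fix U assume U: "openin X U"
    let ?Q' = "subtopology ?XI {z \<in> topspace ?XI. snd z \<le> w (fst z) \<and> w (fst z) > 0}"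
    have "continuous_map ?Q' X P"
      unfolding P_def
    proof (rule continuous_map_compose_pair[OF H])
      show "continuous_map ?Q' X fst"
        by (rule continuous_map_from_subtopology[OF continuous_map_fst])
      have "continuous_map ?Q' euclideanreal (\<lambda>z. snd z / w (fst z))"
        by (intro continuous_map_real_divide continuous_map_from_subtopology[OF sn]
            continuous_map_from_subtopology[OF wf]) auto
      then show "continuous_map ?Q' ?I (\<lambda>z. snd z / w (fst z))"
        using dv by (intro continuous_map_into_subtopology) auto
    qed
    then have "openin ?Q' {z \<in> topspace ?Q'. P z \<in> U}"
      using U by (rule openin_continuous_map_preimage)
    then obtain V where V: "openin ?XI V"
      and V': "{z \<in> topspace ?Q'. P z \<in> U} =
        V \<inter> {z \<in> topspace ?XI. snd z \<le> w (fst z) \<and> w (fst z) > 0}"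
      by (auto simp: openin_subtopology)
    \<comment> \<open>\<open>?T\<close> handles the points over \<open>A\<close>: it consists of the
      points whose whole path under \<open>H\<close> stays in \<open>U\<close>, is open because the
      time interval is compact, and contains each point of \<open>A\<close> that lies in
      \<open>U\<close>, since \<open>H\<close> fixes it.\<close>
    let ?T = "{x \<in> topspace X. \<forall>s \<in> topspace ?I. (x, s) \<in> {z \<in> topspace ?XI. H z \<in> U}}"
    have W: "openin ?XI {z \<in> topspace ?XI. w (fst z) > 0}"
      using wf unfolding continuous_map_upper_lower_semicontinuous_lt by blast
    have "openin X ?T"
      by (intro openin_forall_compact_space openin_continuous_map_preimage[OF H U])
        (simp add: compact_space_subtopology)
    then have "openin ?XI (?T \<times> topspace ?I)"
      unfolding openin_prod_Times_iff by blast
    then have "openin ?XI (V \<inter> {z \<in> topspace ?XI. w (fst z) > 0} \<union> ?T \<times> topspace ?I)"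
      by (intro openin_Un openin_Int V W)
    moreover have "{z \<in> topspace ?Q. P z \<in> U} =
        (V \<inter> {z \<in> topspace ?XI. w (fst z) > 0} \<union> ?T \<times> topspace ?I) \<inter>
        {z \<in> topspace ?XI. snd z \<le> w (fst z)}" (is "?L = ?R")
    proof (intro set_eqI)
      fix z
      show "z \<in> ?L \<longleftrightarrow> z \<in> ?R"
      proof (cases "z \<in> topspace ?Q")
        case False
        then show ?thesis by auto
      next
        case True
        then obtain x s where z: "z = (x, s)" and x: "x \<in> topspace X" and s: "s \<in> {0..1}"
          and sw: "s \<le> w x" by auto
        have T: "P z \<in> U" if "x \<in> ?T"
          using that dv[OF x s sw] unfolding z P_def by simp
        show ?thesis
        proof (cases "w x = 0")
          case True
          then have a: "x \<in> A" using wA[OF x] by simp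
          have "P z = x" using HA[OF a] True by (simp add: P_def z)
          then show ?thesis
            using T True a HA[OF a] x s sw unfolding z by auto
        next
          case False
          with w0[OF x] have "w x > 0" by linarith
          then have "z \<in> V \<longleftrightarrow> P z \<in> U"
            using V'[unfolded set_eq_iff, rule_format, of z] x s sw unfolding z by auto
          then show ?thesis
            using T \<open>w x > 0\<close> x s sw unfolding z by auto
        qed
      qed
    qed
    ultimately show "openin ?Q {z \<in> topspace ?Q. P z \<in> U}"
      unfolding openin_subtopology by (intro exI conjI)
  qed
  \<comment> \<open>The clock of \<open>h\<close> restarts at time \<open>w (fst z)\<close>. The
    branches agree at that moment because the path has then arrived at \<open>H (fst z, 1)\<close>
    in \<open>A\<close>, where \<open>h\<close> starts as \<open>g\<close>. If
    \<open>w (fst z)\<close> exceeds 1, only the first branch occurs.\<close>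
  define k where "k z = (if snd z \<le> w (fst z) then g (P z) else h (H (fst z, 1), snd z - w (fst z)))"
    for z
  show ?case
  proof (intro exI[of _ k] conjI ballI)
    show "continuous_map ?XI Y k"
      unfolding k_def
    proof (rule continuous_map_cases_le[OF sn wf])
      show "continuous_map ?Q Y (\<lambda>z. g (P z))"
        using continuous_map_compose[OF P g] by (simp add: o_def)
      let ?Q' = "subtopology ?XI {z \<in> topspace ?XI. w (fst z) \<le> snd z}"
      show "continuous_map ?Q' Y (\<lambda>z. h (H (fst z, 1), snd z - w (fst z)))"
      proof (rule continuous_map_compose_pair[OF h])
        have "continuous_map ?XI X (\<lambda>z. H (fst z, 1))"
          by (rule continuous_map_compose_pair[OF H continuous_map_fst]) simp
        then show "continuous_map ?Q' (subtopology X A) (\<lambda>z. H (fst z, 1))"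
          by (intro continuous_map_into_subtopology continuous_map_from_subtopology)
            (use H1 in auto)
        have "continuous_map ?Q' euclideanreal (\<lambda>z. snd z - w (fst z))"
          by (intro continuous_map_from_subtopology continuous_map_diff sn wf)
        moreover have "snd z - w (fst z) \<in> {0..1}" if "z \<in> topspace ?Q'" for z
          using that w0[of "fst z"] by auto
        ultimately show "continuous_map ?Q' ?I (\<lambda>z. snd z - w (fst z))"
          by (intro continuous_map_into_subtopology) auto
      qed
      fix z assume z: "z \<in> topspace ?XI" and eq: "snd z = w (fst z)"
      then have x: "fst z \<in> topspace X" by auto
      have "P z = H (fst z, 1)"
      proof (cases "w (fst z) = 0")
        case True
        then have "fst z \<in> A" using wA[OF x] by simp
        then show ?thesis by (simp add: P_def eq True HA)
      qed (simp add: P_def eq)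
      moreover have "H (fst z, 1) \<in> topspace X" using H1[OF x] AX by blast
      ultimately show "g (P z) = h (H (fst z, 1), snd z - w (fst z))"
        using gh[of "H (fst z, 1)"] H1[OF x] by (simp add: eq)
    qed
    show "k (x, 0) = g x" if "x \<in> topspace X" for x
      using that w0[OF that] H0 by (simp add: k_def P_def)
    show "k (a, s) = h (a, s)" if "a \<in> topspace (subtopology X A)" "s \<in> {0..1}" for a s
    proof -
      have a: "a \<in> topspace X" "a \<in> A" "w a = 0" using that wA by auto
      show ?thesis using that a gh HA by (cases "s = 0") (auto simp: k_def P_def)
    qed
  qed
qed

text \<open>Extending the two inclusions into \<open>B\<close> gives a retraction \<open>r\<close>
  onto \<open>B\<close>, and \<open>H\<close> is its first component. If the second component of
  \<open>r (x, 1)\<close> is positive, that point of \<open>B\<close> can only lie over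
  \<open>A\<close>; this open condition defines \<open>U\<close>.\<close>

lemma cofibration_imp_neighbourhood_deformation:
  assumes cof: "cofibration (subtopology X A) X (\<lambda>x. x)" and AX: "A \<subseteq> topspace X"
  obtains U H where "openin X U" and "A \<subseteq> U"
    and "continuous_map (prod_topology X (top_of_set {0..1::real})) X H"
    and "\<And>x. x \<in> topspace X \<Longrightarrow> H (x, 0) = x" and "\<And>x. x \<in> U \<Longrightarrow> H (x, 1) \<in> A"
    and "\<And>a s. a \<in> A \<Longrightarrow> s \<in> {0..1} \<Longrightarrow> H (a, s) = a"
proof -
  let ?I = "top_of_set {0..1::real}"
  let ?XI = "prod_topology X ?I"
  define B where "B = topspace X \<times> {0} \<union> A \<times> {0..1::real}"
  let ?Y = "subtopology ?XI B"
  have "continuous_map X ?XI (\<lambda>x. (x, 0))"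
    by (intro continuous_map_pairedI) auto
  then have 1: "continuous_map X ?Y (\<lambda>x. (x, 0))"
    by (intro continuous_map_into_subtopology) (auto simp: B_def)
  have "prod_topology (subtopology X A) ?I = subtopology ?XI (A \<times> {0..1})"
    by (subst prod_topology_subtopology(1)) simp
  then have 2: "continuous_map (prod_topology (subtopology X A) ?I) ?Y (\<lambda>z. z)"
    by (simp only:, intro continuous_map_into_subtopology continuous_map_from_subtopology)
      (auto simp: B_def)
  \<comment> \<open>The target \<open>?Y\<close> does not live on the type that
    \<open>cofibration\<close> quantifies over, hence the detour through
    \<open>cofibration_homotopy_extension\<close>.\<close>
  obtain r where r: "continuous_map ?XI ?Y r"
    and r0: "\<forall>x \<in> topspace X. r (x, 0) = (x, 0)"
    and rA: "\<forall>a \<in> A. \<forall>s \<in> {0..1}. r (a, s) = (a, s)"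
    using cofibration_homotopy_extension[OF cof, of ?Y, unfolded homotopy_extension_into_def,
        THEN spec, THEN spec, THEN mp, OF conjI[OF 1 conjI[OF 2]]] AX
    by (simp add: Int_absorb1) blast
  have rB: "r z \<in> B" if "z \<in> topspace ?XI" for z
    using r that by (auto simp: continuous_map_in_subtopology simp del: topspace_prod_topology)
  have rc: "continuous_map ?XI ?XI r"
    using r by (simp add: continuous_map_in_subtopology)
  show thesis
  proof
    have "continuous_map X euclideanreal (\<lambda>x. snd (r (x, 1)))"
    proof -
      have "continuous_map X ?XI (\<lambda>x. r (x, 1))"
        by (rule continuous_map_compose_pair[OF rc]) auto
      from continuous_map_compose[OF this continuous_map_into_fulltopology[OF continuous_map_snd]]
      show ?thesis by (simp add: o_def)
    qed
    then show "openin X {x \<in> topspace X. snd (r (x, 1)) > 0}"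
      unfolding continuous_map_upper_lower_semicontinuous_lt by blast
    show "A \<subseteq> {x \<in> topspace X. snd (r (x, 1)) > 0}"
      using AX rA by auto
    show "continuous_map ?XI X (fst \<circ> r)"
      using continuous_map_compose[OF rc continuous_map_fst] .
    show "(fst \<circ> r) (x, 0) = x" if "x \<in> topspace X" for x
      using r0 that by simp
    show "(fst \<circ> r) (x, 1) \<in> A" if "x \<in> {x \<in> topspace X. snd (r (x, 1)) > 0}" for x
      using rB[of "(x, 1)"] that by (auto simp: B_def)
    show "(fst \<circ> r) (a, s) = a" if "a \<in> A" "s \<in> {0..1}" for a s
      using rA that by simp
  qed
qed

section \<open>Attractors of semi-flows\<close>

locale semiflow_attractor =
  fixes M :: "'a topology" and \<phi> :: "real \<Rightarrow> 'a \<Rightarrow> 'a" and A :: "'a set"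
  assumes sds: "semi_dynamical_system M \<phi>" and attractor: "invariant_attractor M \<phi> A"
begin

abbreviation "\<D> \<equiv> domain_of_attraction M \<phi> A"
abbreviation "X \<equiv> subtopology M \<D>"

section \<open>Orbits, the attractor and its domain of attraction\<close>

lemma Hausdorff: "Hausdorff_space M"
  and completely_regular: "completely_regular_space M"
  and locally_compact: "locally_compact_space M"
  using sds locally_compact_regular_imp_completely_regular_space
  by (auto simp: semi_dynamical_system_def)

lemma continuous_map_flow:
  "continuous_map (prod_topology (top_of_set {0..}) M) M (\<lambda>z. \<phi> (fst z) (snd z))"
  using sds by (simp add: semi_dynamical_system_def case_prod_unfold)

lemma continuous_map_flow_compose:
  assumes "continuous_map W (top_of_set {0..}) \<tau>" and "continuous_map W M f"
  shows "continuous_map W M (\<lambda>w. \<phi> (\<tau> w) (f w))"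
  using continuous_map_compose_pair[OF continuous_map_flow assms] by simp

lemma continuous_map_flow_at: "t \<ge> 0 \<Longrightarrow> continuous_map M M (\<phi> t)"
  using continuous_map_flow_compose[of M "\<lambda>_. t" "\<lambda>x. x"] by simp

lemma flow_in: "t \<ge> 0 \<Longrightarrow> x \<in> topspace M \<Longrightarrow> \<phi> t x \<in> topspace M"
  using continuous_map_flow_at by (auto simp: continuous_map_def)

lemma flow_0: "x \<in> topspace M \<Longrightarrow> \<phi> 0 x = x"
  and flow_add: "x \<in> topspace M \<Longrightarrow> s \<ge> 0 \<Longrightarrow> t \<ge> 0 \<Longrightarrow> \<phi> s (\<phi> t x) = \<phi> (t + s) x"
  using sds by (auto simp: semi_dynamical_system_def)

lemma compact_A: "compactin M A" and A_subset: "A \<subseteq> topspace M"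
  using attractor compactin_subset_topspace by (auto simp: invariant_attractor_def)

lemma flow_in_A_iff: "x \<in> topspace M \<Longrightarrow> t \<ge> 0 \<Longrightarrow> \<phi> t x \<in> A \<longleftrightarrow> x \<in> A"
  using attractor invariant_set_iff[OF sds A_subset]
  by (fastforce simp: invariant_attractor_def)

lemma stable:
  assumes "openin M U" and "A \<subseteq> U"
  obtains V where "openin M V" and "A \<subseteq> V" and "\<And>x t. x \<in> V \<Longrightarrow> t \<ge> 0 \<Longrightarrow> \<phi> t x \<in> U"
proof -
  obtain V where "openin M V" "A \<subseteq> V" "(\<Union>t\<in>{0..}. \<phi> t ` V) \<subseteq> U"
    using attractor assms unfolding invariant_attractor_def lyapunov_stable_def by meson
  then show thesis by (intro that[of V]) auto
qed

lemma domain_subset: "\<D> \<subseteq> topspace M"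
  by (auto simp: domain_of_attraction_def)

lemma domainD:
  "x \<in> \<D> \<Longrightarrow> openin M U \<Longrightarrow> A \<subseteq> U \<Longrightarrow> \<exists>T \<ge> 0. \<forall>t \<ge> T. \<phi> t x \<in> U"
  by (auto simp: domain_of_attraction_def)

lemma flow_in_domain_iff:
  assumes x: "x \<in> topspace M" and t: "t \<ge> 0"
  shows "\<phi> t x \<in> \<D> \<longleftrightarrow> x \<in> \<D>"
proof
  assume R: "\<phi> t x \<in> \<D>"
  have "\<exists>T \<ge> 0. \<forall>s \<ge> T. \<phi> s x \<in> U" if U: "openin M U" "A \<subseteq> U" for U
  proof -
    obtain T where T: "T \<ge> 0" "\<And>s. s \<ge> T \<Longrightarrow> \<phi> s (\<phi> t x) \<in> U"
      using domainD[OF R U] by blast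
    have "\<phi> s x \<in> U" if "s \<ge> t + T" for s
      using T(2)[of "s - t"] flow_add[OF x _ t, of "s - t"] that T(1) by simp
    with t T(1) show ?thesis by (intro exI[of _ "t + T"]) auto
  qed
  with x show "x \<in> \<D>" by (auto simp: domain_of_attraction_def)
next
  assume R: "x \<in> \<D>"
  have "\<exists>T \<ge> 0. \<forall>s \<ge> T. \<phi> s (\<phi> t x) \<in> U" if U: "openin M U" "A \<subseteq> U" for U
  proof -
    obtain T where T: "T \<ge> 0" "\<And>s. s \<ge> T \<Longrightarrow> \<phi> s x \<in> U"
      using domainD[OF R U] by blast
    then have "\<phi> s (\<phi> t x) \<in> U" if "s \<ge> T" for s
      using flow_add[OF x _ t, of s] that t by simp
    with T(1) show ?thesis by blast
  qed
  with x t show "\<phi> t x \<in> \<D>" by (auto simp: domain_of_attraction_def flow_in)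
qed

text \<open>The neighbourhood \<open>W\<close> from local attractivity lies in the domain. Every
  orbit of the domain enters \<open>W\<close>, and by \<open>flow_in_domain_iff\<close> a point
  whose orbit enters \<open>W\<close> belongs to the domain; so the domain is a union of open
  preimages of \<open>W\<close>.\<close>

lemma A_subset_domain: "A \<subseteq> \<D>" and openin_domain: "openin M \<D>"
proof -
  obtain W where W: "openin M W" "A \<subseteq> W"
    and Wa: "\<And>p V. p \<in> W \<Longrightarrow> openin M V \<Longrightarrow> A \<subseteq> V \<Longrightarrow> \<exists>T \<ge> 0. \<forall>t \<ge> T. \<phi> t p \<in> V"
    using attractor unfolding invariant_attractor_def locally_attractive_def by auto
  have WD: "W \<subseteq> \<D>"
    using openin_subset[OF W(1)] Wa by (auto simp: domain_of_attraction_def)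
  with W show "A \<subseteq> \<D>" by blast
  have "\<D> = (\<Union>t\<in>{0..}. {x \<in> topspace M. \<phi> t x \<in> W})"
    using WD domainD[OF _ W] domain_subset flow_in_domain_iff by fastforce
  moreover have "openin M (\<Union>t\<in>{0..}. {x \<in> topspace M. \<phi> t x \<in> W})"
    by (intro openin_clauses(3)) (auto intro: openin_continuous_map_preimage continuous_map_flow_at W)
  ultimately show "openin M \<D>" by simp
qed

lemma topspace_X: "topspace X = \<D>"
  using domain_subset by auto

text \<open>By stability, being in \<open>V\<close> once means staying in \<open>U\<close> from then
  on. Hence the preimages of \<open>V\<close> under integer times cover \<open>K\<close>, and
  finitely many of these times suffice.\<close>

lemma uniformly_attracted:
  assumes K: "compactin M K" "K \<subseteq> \<D>" and U: "openin M U" "A \<subseteq> U"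
  obtains T where "T \<ge> 0" and "\<And>x t. x \<in> K \<Longrightarrow> t \<ge> T \<Longrightarrow> \<phi> t x \<in> U"
proof -
  obtain V where V: "openin M V" "A \<subseteq> V" and VU: "\<And>x t. x \<in> V \<Longrightarrow> t \<ge> 0 \<Longrightarrow> \<phi> t x \<in> U"
    using stable[OF U] by blast
  let ?P = "\<lambda>n::nat. {x \<in> topspace M. \<phi> (real n) x \<in> V}"
  have "K \<subseteq> \<Union>(range ?P)"
  proof
    fix x assume "x \<in> K"
    then obtain T where "\<forall>t \<ge> T. \<phi> t x \<in> V" using domainD[OF _ V] K by blast
    moreover obtain n :: nat where "T \<le> n" using real_arch_simple by blast
    ultimately show "x \<in> \<Union>(range ?P)" using \<open>x \<in> K\<close> K domain_subset by blast
  qed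
  moreover have "openin M S" if "S \<in> range ?P" for S
    using that openin_continuous_map_preimage[OF continuous_map_flow_at V(1)] by auto
  ultimately obtain F where "finite F" "F \<subseteq> range ?P" and KF: "K \<subseteq> \<Union>F"
    using K(1) unfolding compactin_def by meson
  then obtain N where N: "finite N" "F = ?P ` N" by (meson finite_subset_image)
  show thesis
  proof
    \<comment> \<open>The sum of the times in \<open>N\<close> bounds each of them, and it needs no
      exception for empty \<open>N\<close> as a maximum would.\<close>
    fix x t assume x: "x \<in> K" and t: "t \<ge> real (\<Sum>N)"
    then obtain n where n: "n \<in> N" "\<phi> (real n) x \<in> V" using KF N by auto
    have "n \<le> \<Sum>N" using n N member_le_sum[of n N "\<lambda>n. n"] by simp
    with t have nt: "real n \<le> t" by linarith
    with VU[OF n(2), of "t - n"] x show "\<phi> t x \<in> U"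
      using flow_add[of x "t - n" n] K domain_subset by auto
  qed (simp add: sum_nonneg)
qed

section \<open>A Lyapunov function and a continuous entrance time\<close>

text \<open>\<open>u\<close> is the supremum of \<open>f\<close> over the forward orbit, so it
  cannot increase along orbits. As a supremum of continuous functions it is lower semicontinuous;
  upper semicontinuity comes from stability, which controls all late times at once, and from
  compactness of the remaining time interval.\<close>

lemma lyapunov_function:
  assumes f: "continuous_map M (top_of_set {0..1::real}) f" and fA: "f ` A \<subseteq> {0}"
  obtains u where "continuous_map X euclideanreal u" and "\<And>x. x \<in> \<D> \<Longrightarrow> 0 \<le> u x"
    and "\<And>x. x \<in> \<D> \<Longrightarrow> f x \<le> u x" and "\<And>x. x \<in> A \<Longrightarrow> u x = 0"
    and "\<And>x t. x \<in> \<D> \<Longrightarrow> t \<ge> 0 \<Longrightarrow> u (\<phi> t x) \<le> u x"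
    and "\<And>x e. x \<in> \<D> \<Longrightarrow> e > 0 \<Longrightarrow> \<exists>t \<ge> 0. u (\<phi> t x) < e"
proof -
  have fR: "continuous_map M euclideanreal f"
    using f by (rule continuous_map_into_fulltopology)
  have f01: "0 \<le> f x" "f x \<le> 1" if "x \<in> topspace M" for x
    using f that by (auto simp: continuous_map_def Pi_iff)
  define u where "u x = (SUP t\<in>{0..}. f (\<phi> t x))" for x
  have in_M: "x \<in> topspace M" if "x \<in> \<D>" for x using that domain_subset by blast
  have bdd: "bdd_above ((\<lambda>t. f (\<phi> t x)) ` {0..})" if "x \<in> \<D>" for x
    using f01(2) flow_in in_M[OF that] by (intro bdd_aboveI[of _ 1]) auto
  have upper: "f (\<phi> t x) \<le> u x" if "x \<in> \<D>" "t \<ge> 0" for x t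
    unfolding u_def using that by (intro cSUP_upper bdd) auto
  have least: "u x \<le> c" if "\<And>t. t \<ge> 0 \<Longrightarrow> f (\<phi> t x) \<le> c" for x c
    unfolding u_def using that by (intro cSUP_least) auto
  have fu: "f x \<le> u x" if "x \<in> \<D>" for x
    using upper[OF that, of 0] flow_0 in_M[OF that] by simp
  have u0: "0 \<le> u x" if "x \<in> \<D>" for x
    using fu[OF that] f01 in_M[OF that] by force
  \<comment> \<open>Attraction brings \<open>x\<close> into a neighbourhood of \<open>A\<close> from
    which \<open>f\<close> stays below \<open>c\<close>. As this neighbourhood is open, orbits
    starting near \<open>x\<close> are in it at the same time \<open>T\<close>.\<close>
  have tail: "\<exists>T \<ge> 0. \<exists>V. openin M V \<and> \<phi> T x \<in> V \<and> (\<forall>y \<in> V. \<forall>t \<ge> 0. f (\<phi> t y) < c)"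
    if x: "x \<in> \<D>" and c: "c > 0" for x c
  proof -
    have "openin M {y \<in> topspace M. f y < c}"
      using fR unfolding continuous_map_upper_lower_semicontinuous_lt by blast
    moreover have "A \<subseteq> {y \<in> topspace M. f y < c}" using fA A_subset c by auto
    ultimately obtain V where V: "openin M V" "A \<subseteq> V"
      and Vf: "\<And>y t. y \<in> V \<Longrightarrow> t \<ge> 0 \<Longrightarrow> \<phi> t y \<in> {y \<in> topspace M. f y < c}"
      using stable by blast
    obtain T where "T \<ge> 0" "\<forall>t \<ge> T. \<phi> t x \<in> V" using domainD[OF x V] by blast
    with V Vf show ?thesis by (intro exI[of _ T] conjI exI[of _ V]) auto
  qed
  show thesis
  proof
    show "0 \<le> u x" if "x \<in> \<D>" for x using u0 that .
    show "f x \<le> u x" if "x \<in> \<D>" for x using fu that .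
    show "u x = 0" if "x \<in> A" for x
    proof -
      have "f (\<phi> t x) = 0" if "t \<ge> 0" for t
        using flow_in_A_iff[of x t] that \<open>x \<in> A\<close> A_subset fA by auto
      then have "u x \<le> 0" by (intro least) simp
      moreover have "0 \<le> u x" using that A_subset_domain by (intro u0) blast
      ultimately show ?thesis by simp
    qed
    show "u (\<phi> t x) \<le> u x" if "x \<in> \<D>" "t \<ge> 0" for x t
    proof (rule least)
      fix s :: real assume "s \<ge> 0"
      then show "f (\<phi> s (\<phi> t x)) \<le> u x"
        using upper[OF that(1), of "t + s"] flow_add[OF in_M[OF that(1)]] that(2) by simp
    qed
    show "\<exists>t \<ge> 0. u (\<phi> t x) < e" if x: "x \<in> \<D>" and e: "e > 0" for x e
    proof -
      obtain T V where "T \<ge> 0" "\<phi> T x \<in> V" "\<forall>y \<in> V. \<forall>t \<ge> 0. f (\<phi> t y) < e/2"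
        using tail[OF x, of "e/2"] e by auto
      moreover from this have "u (\<phi> T x) \<le> e/2" by (intro least) (auto intro: less_imp_le)
      ultimately show ?thesis using e by (intro exI[of _ T]) auto
    qed
    show "continuous_map X euclideanreal u"
      unfolding continuous_map_upper_lower_semicontinuous_lt topspace_X
    proof (intro conjI allI)
      fix c
      have "c < u x \<longleftrightarrow> (\<exists>t\<in>{0..}. c < f (\<phi> t x))" if "x \<in> \<D>" for x
        unfolding u_def by (rule less_cSUP_iff[OF _ bdd[OF that]]) simp
      then have "{x \<in> \<D>. c < u x} = (\<Union>t\<in>{0..}. {x \<in> \<D>. c < f (\<phi> t x)})"
        by blast
      moreover have "openin X {x \<in> \<D>. c < f (\<phi> t x)}" if "t \<ge> 0" for t
      proof -
        have "continuous_map X euclideanreal (f \<circ> \<phi> t)"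
          using continuous_map_flow_at[OF that] fR
          by (intro continuous_map_compose continuous_map_from_subtopology)
        then show ?thesis
          unfolding continuous_map_upper_lower_semicontinuous_lt topspace_X o_def by blast
      qed
      ultimately show "openin X {x \<in> \<D>. c < u x}"
        by (simp only:) (intro openin_Union, blast)
    next
      fix c
      show "openin X {x \<in> \<D>. u x < c}"
      proof (subst openin_subopen, intro ballI)
        fix x assume "x \<in> {x \<in> \<D>. u x < c}"
        then have x: "x \<in> \<D>" and "u x < c" by auto
        \<comment> \<open>The margin \<open>b\<close> is needed because values of \<open>f\<close>
          below \<open>b\<close> along an orbit only bound their supremum by \<open>b\<close>, not
          strictly.\<close>
        then obtain b where b: "u x < b" "b < c" using dense by blast
        with u0[OF x] have "b > 0" by linarith
        obtain T V where T: "T \<ge> 0" and V: "openin M V" "\<phi> T x \<in> V"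
          and Vb: "\<forall>y \<in> V. \<forall>t \<ge> 0. f (\<phi> t y) < b" using tail[OF x \<open>b > 0\<close>] by (elim exE conjE, intro that)
        let ?J = "top_of_set {0..T}"
        let ?W = "{z \<in> topspace (prod_topology X ?J). f (\<phi> (snd z) (fst z)) < b}"
        \<comment> \<open>\<open>?N\<close> keeps \<open>f\<close> below \<open>b\<close> up to time
          \<open>T\<close>; the preimage of \<open>V\<close> under \<open>\<phi> T\<close> takes
          care of all later times.\<close>
        let ?N = "{y \<in> topspace X. \<forall>t \<in> topspace ?J. (y, t) \<in> ?W}"
        have "continuous_map (prod_topology X ?J) M (\<lambda>z. \<phi> (snd z) (fst z))"
        proof (rule continuous_map_flow_compose)
          show "continuous_map (prod_topology X ?J) (top_of_set {0..}) snd"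
            by (intro continuous_map_into_subtopology
                continuous_map_into_fulltopology[OF continuous_map_snd]) auto
          show "continuous_map (prod_topology X ?J) M fst"
            by (rule continuous_map_into_fulltopology[OF continuous_map_fst])
        qed
        from continuous_map_compose[OF this fR]
        have "openin (prod_topology X ?J) ?W"
          unfolding continuous_map_upper_lower_semicontinuous_lt o_def by blast
        then have N: "openin X ?N"
          by (intro openin_forall_compact_space) (simp add: compact_space_subtopology)
        have "openin X {y \<in> topspace X. \<phi> T y \<in> V}"
          by (intro openin_continuous_map_preimage[OF _ V(1)] continuous_map_from_subtopology
              continuous_map_flow_at T)
        with N have "openin X (?N \<inter> {y \<in> topspace X. \<phi> T y \<in> V})" by (rule openin_Int)
        moreover have "x \<in> ?N \<inter> {y \<in> topspace X. \<phi> T y \<in> V}"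
          using x V(2) le_less_trans[OF upper[OF x] b(1)] in_M[OF x] by auto
        moreover have "?N \<inter> {y \<in> topspace X. \<phi> T y \<in> V} \<subseteq> {x \<in> \<D>. u x < c}"
        proof
          fix y assume y: "y \<in> ?N \<inter> {y \<in> topspace X. \<phi> T y \<in> V}"
          have "f (\<phi> t y) < b" if "t \<ge> 0" for t
          proof (cases "t \<le> T")
            case True
            with y that show ?thesis by auto
          next
            case False
            then have "f (\<phi> (t - T) (\<phi> T y)) < b" using Vb y by auto
            with False T y show ?thesis using flow_add[of y "t - T" T] by auto
          qed
          then have "u y \<le> b" by (intro least) (auto intro: less_imp_le)
          with b y show "y \<in> {x \<in> \<D>. u x < c}" by auto
        qed
        ultimately show "\<exists>S. openin X S \<and> x \<in> S \<and> S \<subseteq> {x \<in> \<D>. u x < c}" by blast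
      qed
    qed
  qed
qed

text \<open>The time is read off as the unique zero of \<open>t \<mapsto> u (\<phi> t x) - t / (1 + t)\<close>, which is strictly
  decreasing because \<open>u\<close> does not increase along orbits; its zero therefore depends continuously
  on \<open>x\<close>, which a first entry time need not do.\<close>

lemma continuous_entrance_time:
  assumes U: "openin M U" "A \<subseteq> U"
  obtains \<tau> where "continuous_map X (top_of_set {0..}) \<tau>"
    and "\<And>x. x \<in> \<D> \<Longrightarrow> \<phi> (\<tau> x) x \<in> U" and "\<And>x. x \<in> A \<Longrightarrow> \<tau> x = 0"
proof -
  have "closedin M (topspace M - U)" "disjnt (topspace M - U) A"
    using U by (auto simp: disjnt_def)
  then obtain f where f: "continuous_map M (top_of_set {0..1::real}) f" "f ` A \<subseteq> {0}"
    and f1: "f ` (topspace M - U) \<subseteq> {1}"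
    by (rule Urysohn_completely_regular_closed_compact[OF zero_le_one completely_regular _ compact_A])
  obtain u where u: "continuous_map X euclideanreal u" and u0: "\<And>x. x \<in> \<D> \<Longrightarrow> 0 \<le> u x"
    and fu: "\<And>x. x \<in> \<D> \<Longrightarrow> f x \<le> u x" and uA: "\<And>x. x \<in> A \<Longrightarrow> u x = 0"
    and mono: "\<And>x t. x \<in> \<D> \<Longrightarrow> t \<ge> 0 \<Longrightarrow> u (\<phi> t x) \<le> u x"
    and small: "\<And>x e. x \<in> \<D> \<Longrightarrow> e > 0 \<Longrightarrow> \<exists>t \<ge> 0. u (\<phi> t x) < e"
    by (rule lyapunov_function[OF f], rule that, assumption) simp_all
  \<comment> \<open>The subtracted term starts at 0, so \<open>\<tau>\<close> vanishes on
    \<open>A\<close>; it increases strictly; and it stays below 1, so at the zero \<open>f\<close>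
    is less than 1, which forces the point into \<open>U\<close>.\<close>
  define F where "F x t = u (\<phi> t x) - t / (1 + t)" for x t
  have flow: "\<phi> t x \<in> \<D>" if "x \<in> \<D>" "t \<ge> 0" for x t
    using that flow_in_domain_iff domain_subset by blast
  have decr: "u (\<phi> t x) \<le> u (\<phi> s x)" if "x \<in> \<D>" "0 \<le> s" "s \<le> t" for x s t
    using mono[OF flow[OF that(1,2)], of "t - s"] flow_add[of x "t - s" s] that domain_subset by auto
  have strict: "F x t < F x s" if "x \<in> \<D>" "0 \<le> s" "s < t" for x s t
  proof -
    have "s / (1 + s) < t / (1 + t)" using that by (simp add: field_simps)
    with decr[OF that(1,2), of t] that show ?thesis by (simp add: F_def)
  qed
  \<comment> \<open>The general source \<open>W\<close> covers both uses: \<open>x\<close> fixed and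
    time varying for the intermediate value theorem, time fixed and \<open>x\<close> varying for the
    continuity of \<open>\<tau>\<close>.\<close>
  have cont: "continuous_map W euclideanreal (\<lambda>w. F (g w) (\<sigma> w))"
    if g: "continuous_map W X g" and \<sigma>: "continuous_map W (top_of_set {0..}) \<sigma>" for W :: "'w topology" and g \<sigma>
  proof -
    have gM: "continuous_map W M g" using g by (rule continuous_map_into_fulltopology)
    have s0: "0 \<le> \<sigma> w" if "w \<in> topspace W" for w
      using \<sigma> that by (auto simp: continuous_map_def Pi_iff)
    have "continuous_map W X (\<lambda>w. \<phi> (\<sigma> w) (g w))"
    proof (rule continuous_map_into_subtopology)
      show "continuous_map W M (\<lambda>w. \<phi> (\<sigma> w) (g w))"
        by (rule continuous_map_flow_compose[OF \<sigma> gM])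
      show "(\<lambda>w. \<phi> (\<sigma> w) (g w)) \<in> topspace W \<rightarrow> \<D>"
        using g s0 flow by (auto simp: continuous_map_in_subtopology)
    qed
    from continuous_map_compose[OF this u]
    have 1: "continuous_map W euclideanreal (\<lambda>w. u (\<phi> (\<sigma> w) (g w)))" by (simp add: o_def)
    have "1 + \<sigma> w \<noteq> 0" if "w \<in> topspace W" for w using s0[OF that] by linarith
    then show ?thesis
      unfolding F_def
      by (intro continuous_map_diff 1 continuous_map_real_divide continuous_map_add
          continuous_map_into_fulltopology[OF \<sigma>]) auto
  qed
  have "\<exists>t \<ge> 0. F x t = 0" if x: "x \<in> \<D>" for x
  proof -
    obtain s where s: "s \<ge> 0" "u (\<phi> s x) < 1/2" using small[OF x, of "1/2"] by auto
    \<comment> \<open>From time 1 on the subtracted term is at least 1/2, and from time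
      \<open>s\<close> on \<open>u\<close> is below 1/2.\<close>
    define b where "b = max s 1"
    have b: "b \<ge> 1" "b \<ge> s" by (auto simp: b_def)
    have "u (\<phi> b x) < 1/2" using decr[OF x s(1) b(2)] s(2) by linarith
    moreover have "1/2 \<le> b / (1 + b)" using b by (simp add: field_simps)
    ultimately have "F x b \<le> 0" unfolding F_def by linarith
    moreover have "0 \<le> F x 0" using x u0 flow_0 domain_subset by (auto simp: F_def)
    moreover have "continuous_on {0..b} (F x)"
    proof -
      have "continuous_map (top_of_set {0..b}) euclideanreal (\<lambda>t. F x t)"
        by (rule cont) (use x domain_subset b in \<open>auto intro!: continuous_map_into_subtopology\<close>)
      then show ?thesis by simp
    qed
    ultimately show ?thesis using IVT2'[of "F x" b 0 0] b by auto
  qed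
  then obtain \<tau> where t0: "\<And>x. x \<in> \<D> \<Longrightarrow> 0 \<le> \<tau> x" and Ft: "\<And>x. x \<in> \<D> \<Longrightarrow> F x (\<tau> x) = 0"
    by metis
  \<comment> \<open>Comparing \<open>\<tau> x\<close> with a constant \<open>c\<close> becomes a
    sign condition on \<open>F x c\<close>, which is continuous in \<open>x\<close>; both
    semicontinuity conditions follow.\<close>
  have lt: "\<tau> x < c \<longleftrightarrow> F x c < 0" and gt: "c < \<tau> x \<longleftrightarrow> 0 < F x c" if "x \<in> \<D>" "c \<ge> 0" for x c
    using strict[OF that(1) that(2), of "\<tau> x"] strict[OF that(1) t0[OF that(1)], of c] Ft[OF that(1)]
    by (cases c "\<tau> x" rule: linorder_cases; force)+
  show thesis
  proof
    have Fc: "continuous_map X euclideanreal (\<lambda>x. F x c)" if "c \<ge> 0" for c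
      by (rule cont) (use that in auto)
    have "continuous_map X euclideanreal \<tau>"
      unfolding continuous_map_upper_lower_semicontinuous_lt topspace_X
    proof (intro conjI allI)
      fix c
      show "openin X {x \<in> \<D>. c < \<tau> x}"
      proof (cases "c \<ge> 0")
        case True
        then have "{x \<in> \<D>. c < \<tau> x} = {x \<in> \<D>. 0 < F x c}" using gt by auto
        with Fc[OF True] show ?thesis
          unfolding continuous_map_upper_lower_semicontinuous_lt topspace_X by simp
      next
        case False
        then have "{x \<in> \<D>. c < \<tau> x} = topspace X" using t0 topspace_X by fastforce
        then show ?thesis by (simp only: openin_topspace)
      qed
      show "openin X {x \<in> \<D>. \<tau> x < c}"
      proof (cases "c \<ge> 0")
        case True
        then have "{x \<in> \<D>. \<tau> x < c} = {x \<in> \<D>. F x c < 0}" using lt by auto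
        with Fc[OF True] show ?thesis
          unfolding continuous_map_upper_lower_semicontinuous_lt topspace_X by simp
      next
        case False
        then have "{x \<in> \<D>. \<tau> x < c} = {}" using t0 by fastforce
        then show ?thesis by (simp only: openin_empty)
      qed
    qed
    then show "continuous_map X (top_of_set {0..}) \<tau>"
      using t0 by (intro continuous_map_into_subtopology) auto
    show "\<phi> (\<tau> x) x \<in> U" if x: "x \<in> \<D>" for x
    proof (rule ccontr)
      assume "\<phi> (\<tau> x) x \<notin> U"
      moreover have "\<phi> (\<tau> x) x \<in> topspace M" using flow[OF x t0[OF x]] domain_subset by blast
      ultimately have "f (\<phi> (\<tau> x) x) = 1" using f1 by auto
      then have "1 \<le> u (\<phi> (\<tau> x) x)" using fu[OF flow[OF x t0[OF x]]] by simp
      also have "\<dots> = \<tau> x / (1 + \<tau> x)" using Ft[OF x] by (simp add: F_def)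
      also have "\<dots> < 1" using t0[OF x] by simp
      finally show False by simp
    qed
    show "\<tau> x = 0" if "x \<in> A" for x
    proof -
      have x: "x \<in> \<D>" using that A_subset_domain by blast
      have "F x 0 = 0" using that uA x flow_0 domain_subset by (auto simp: F_def)
      with gt[OF x, of 0] t0[OF x] show ?thesis by simp
    qed
  qed
qed

lemma cofibration_imp_strong_deformation_retract:
  assumes "cofibration (subtopology M A) X (\<lambda>x. x)"
  shows "A strong_deformation_retract_of_space X"
proof -
  let ?I = "top_of_set {0..1::real}"
  let ?XI = "prod_topology X ?I"
  have cof: "cofibration (subtopology X A) X (\<lambda>x. x)" and AX: "A \<subseteq> topspace X"
    using assms A_subset_domain topspace_X by (simp_all add: subtopology_subtopology Int_absorb1)
  obtain U H where U: "openin X U" "A \<subseteq> U" and H: "continuous_map ?XI X H"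
    and H0: "\<And>x. x \<in> topspace X \<Longrightarrow> H (x, 0) = x" and H1: "\<And>x. x \<in> U \<Longrightarrow> H (x, 1) \<in> A"
    and HA: "\<And>a s. a \<in> A \<Longrightarrow> s \<in> {0..1} \<Longrightarrow> H (a, s) = a"
    by (rule cofibration_imp_neighbourhood_deformation[OF cof AX], rule that) simp_all
  \<comment> \<open>\<open>U\<close> is open only relative to the domain so far; it is open in
    \<open>M\<close> because the domain is.\<close>
  have "openin M U" using U(1) openin_domain by (rule openin_trans_full)
  then obtain \<tau> where \<tau>: "continuous_map X (top_of_set {0..}) \<tau>"
    and \<tau>U: "\<And>x. x \<in> \<D> \<Longrightarrow> \<phi> (\<tau> x) x \<in> U" and \<tau>A: "\<And>x. x \<in> A \<Longrightarrow> \<tau> x = 0"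
    using continuous_entrance_time U(2) by blast
  have \<tau>0: "0 \<le> \<tau> x" if "x \<in> \<D>" for x
    using \<tau> that topspace_X by (auto simp: continuous_map_def Pi_iff)
  have in_M: "x \<in> topspace M" if "x \<in> \<D>" for x using that domain_subset by blast
  have flowX: "continuous_map W X (\<lambda>w. \<phi> (\<sigma> w) (g w))"
    if "continuous_map W (top_of_set {0..}) \<sigma>" "continuous_map W X g" for W :: "'w topology" and \<sigma> g
  proof (rule continuous_map_into_subtopology)
    show "continuous_map W M (\<lambda>w. \<phi> (\<sigma> w) (g w))"
      by (rule continuous_map_flow_compose[OF that(1) continuous_map_into_fulltopology[OF that(2)]])
    show "(\<lambda>w. \<phi> (\<sigma> w) (g w)) \<in> topspace W \<rightarrow> \<D>"
    proof
      fix w assume "w \<in> topspace W"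
      then have "0 \<le> \<sigma> w" "g w \<in> \<D>"
        using that by (auto simp: continuous_map_in_subtopology)
      then show "\<phi> (\<sigma> w) (g w) \<in> \<D>" using flow_in_domain_iff in_M by simp
    qed
  qed
  have f: "continuous_map ?XI X fst" by (rule continuous_map_fst)
  have s: "continuous_map ?XI euclideanreal snd"
    by (rule continuous_map_into_fulltopology[OF continuous_map_snd])
  have \<tau>f: "continuous_map ?XI (top_of_set {0..}) (\<lambda>z. \<tau> (fst z))"
    using continuous_map_compose[OF f \<tau>] by (simp add: o_def)
  \<comment> \<open>The phases match at time 1/2 because \<open>H\<close> starts at the identity. On
    \<open>A\<close> the entrance time is 0, so the flow phase rests there and \<open>H\<close>
    fixes the point afterwards.\<close>
  define G where "G z = (if snd z \<le> 1/2 then \<phi> (2 * snd z * \<tau> (fst z)) (fst z)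
      else H (\<phi> (\<tau> (fst z)) (fst z), 2 * snd z - 1))" for z
  have "continuous_map ?XI X G"
    unfolding G_def
  proof (rule continuous_map_cases_le[OF s])
    let ?L = "subtopology ?XI {z \<in> topspace ?XI. snd z \<le> 1/2}"
    let ?R = "subtopology ?XI {z \<in> topspace ?XI. 1/2 \<le> snd z}"
    show "continuous_map ?L X (\<lambda>z. \<phi> (2 * snd z * \<tau> (fst z)) (fst z))"
    proof (rule continuous_map_from_subtopology, rule flowX[OF _ f])
      have "continuous_map ?XI euclideanreal (\<lambda>z. 2 * snd z * \<tau> (fst z))"
        by (intro continuous_map_real_mult s continuous_map_into_fulltopology[OF \<tau>f]) simp
      then show "continuous_map ?XI (top_of_set {0..}) (\<lambda>z. 2 * snd z * \<tau> (fst z))"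
        using \<tau>0 by (intro continuous_map_into_subtopology) auto
    qed
    show "continuous_map ?R X (\<lambda>z. H (\<phi> (\<tau> (fst z)) (fst z), 2 * snd z - 1))"
    proof (rule continuous_map_compose_pair[OF H])
      show "continuous_map ?R X (\<lambda>z. \<phi> (\<tau> (fst z)) (fst z))"
        by (intro continuous_map_from_subtopology flowX \<tau>f f)
      have "continuous_map ?R euclideanreal (\<lambda>z. 2 * snd z - 1)"
        by (intro continuous_map_from_subtopology continuous_map_diff continuous_map_real_mult s)
          auto
      then show "continuous_map ?R ?I (\<lambda>z. 2 * snd z - 1)"
        by (intro continuous_map_into_subtopology) auto
    qed
    fix z assume "z \<in> topspace ?XI" and eq: "snd z = 1/2"
    then have "fst z \<in> \<D>" by auto
    then show "\<phi> (2 * snd z * \<tau> (fst z)) (fst z) = H (\<phi> (\<tau> (fst z)) (fst z), 2 * snd z - 1)"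
      using H0 \<tau>0 in_M flow_in_domain_iff by (simp add: eq topspace_X flow_in)
  qed simp
  moreover have "G (x, 0) = x" "G (x, 1) \<in> A" if "x \<in> topspace X" for x
    using that flow_0 H1 \<tau>U by (auto simp: G_def)
  moreover have "G (a, s) = a" if "a \<in> A" "s \<in> {0..1}" for a s
    using that \<tau>A HA flow_0 A_subset by (auto simp: G_def)
  ultimately show ?thesis
    using AX unfolding strong_deformation_retract_of_space_def by blast
qed

section \<open>The attractor as the zero set of a continuous function\<close>

text \<open>Following \<open>x\<close> backwards inside \<open>K\<close> for as long as possible, at most for time \<open>T\<close>: as the last
  point is not a start point, the trajectory can only get stuck outside the interior of \<open>K\<close>.\<close>

lemma backward_exit:
  assumes no_start: "start_points M \<phi> = {}" and K: "compactin M K" and T: "T \<ge> 0"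
    and x: "x \<in> K" "x \<notin> \<phi> T ` K"
  obtains s y where "s \<in> {0..T}" and "y \<in> K - M interior_of K" and "\<phi> s y = x"
proof -
  let ?P = "prod_topology (top_of_set {0..}) M"
  \<comment> \<open>\<open>?S\<close> holds the pairs of a time in \<open>{0..T}\<close> and a point
    of \<open>K\<close> that flows to \<open>x\<close> in that time. It is compact, so a longest
    such time \<open>s\<close> exists.\<close>
  let ?S = "{z \<in> topspace ?P. \<phi> (fst z) (snd z) \<in> {x}} \<inter> ({0..T} \<times> K)"
  have KM: "K \<subseteq> topspace M" using K by (rule compactin_subset_topspace)
  have "closedin M {x}"
    using Hausdorff x(1) KM by (meson closedin_Hausdorff_singleton subsetD)
  then have "closedin ?P {z \<in> topspace ?P. \<phi> (fst z) (snd z) \<in> {x}}"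
    by (rule closedin_continuous_map_preimage[OF continuous_map_flow])
  moreover have "compactin ?P ({0..T} \<times> K)"
    using K by (simp add: compactin_Times compactin_subtopology)
  ultimately have "compactin ?P ?S"
    by (rule closed_Int_compactin)
  from image_compactin[OF this continuous_map_fst] have "compact (fst ` ?S)"
    by (simp add: compactin_subtopology)
  moreover have "(0, x) \<in> ?S" using x KM T flow_0 by auto
  then have "fst ` ?S \<noteq> {}" by blast
  ultimately obtain s where s: "s \<in> fst ` ?S" and s_max: "\<And>r. r \<in> fst ` ?S \<Longrightarrow> r \<le> s"
    using compact_attains_sup[of "fst ` ?S"] by blast
  then obtain y where y: "y \<in> K" "\<phi> s y = x" and sT: "0 \<le> s" "s \<le> T" by auto
  have "y \<notin> M interior_of K"
  proof
    assume yK: "y \<in> M interior_of K"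
    from y x(2) have "s \<noteq> T" by auto
    with sT have "s < T" by simp
    have "y \<in> topspace M" using y(1) KM by blast
    with no_start obtain t z where t: "t > 0" and z: "z \<in> topspace M" and tz: "\<phi> t z = y"
      unfolding start_points_def by blast
    \<comment> \<open>This path runs backwards in time from \<open>y\<close> towards its predecessor
      \<open>z\<close>, and by continuity it stays in the interior of \<open>K\<close> for a
      while.\<close>
    have "continuous_map (top_of_set {0..t}) M (\<lambda>r. \<phi> (t - r) z)"
      by (rule continuous_map_flow_compose)
        (use z in \<open>auto intro!: continuous_map_into_subtopology continuous_intros\<close>)
    from openin_continuous_map_preimage[OF this openin_interior_of[of M K]]
    have "openin (top_of_set {0..t}) {r \<in> {0..t}. \<phi> (t - r) z \<in> M interior_of K}" by simp
    moreover have "0 \<in> {r \<in> {0..t}. \<phi> (t - r) z \<in> M interior_of K}" using t tz yK by simp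
    ultimately obtain e where e: "e > 0"
      and eK: "\<And>r. r \<in> {0..t} \<Longrightarrow> dist r 0 < e \<Longrightarrow> \<phi> (t - r) z \<in> M interior_of K"
      unfolding openin_euclidean_subtopology_iff by blast
    \<comment> \<open>\<open>r\<close> is small enough to remain in \<open>K\<close>, not to pass
      \<open>z\<close>, and to keep \<open>s + r\<close> within \<open>T\<close>; a start
      \<open>r\<close> earlier contradicts the maximality of \<open>s\<close>.\<close>
    define r where "r = min (e/2) (min t (T - s))"
    have r: "0 < r" "r \<le> t" "r \<le> T - s" "r < e"
      using e t \<open>s < T\<close> by (auto simp: r_def)
    then have rK: "\<phi> (t - r) z \<in> K" using eK[of r] interior_of_subset by fastforce
    have rM: "\<phi> (t - r) z \<in> topspace M" using rK KM by blast
    have "\<phi> r (\<phi> (t - r) z) = y"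
      using flow_add[OF z, of r "t - r"] r tz by simp
    then have "\<phi> (s + r) (\<phi> (t - r) z) = x"
      using flow_add[OF rM, of s r] r sT y by (simp add: add.commute)
    then have "(s + r, \<phi> (t - r) z) \<in> ?S" using rK rM r sT by auto
    then have "s + r \<le> s" using s_max by force
    with r show False by simp
  qed
  with y sT show thesis by (intro that[of s y]) auto
qed

text \<open>By \<open>backward_exit\<close>, an interior point of \<open>K\<close> missed by the
  image of \<open>K\<close> under \<open>\<phi> T\<close> is swept out within time \<open>T\<close>
  from \<open>K\<close> minus its interior. The set \<open>C\<close> of all points swept out so is
  compact, hence closed, and removing it leaves a neighbourhood of \<open>A\<close>.\<close>

lemma neighbourhood_within_flow_image:
  assumes no_start: "start_points M \<phi> = {}" and K: "compactin M K" and T: "T \<ge> 0"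
    and AK: "A \<subseteq> M interior_of K"
  obtains N where "openin M N" and "A \<subseteq> N" and "N \<subseteq> \<phi> T ` K"
proof -
  let ?P = "prod_topology (top_of_set {0..}) M"
  define C where "C = (\<lambda>z. \<phi> (fst z) (snd z)) ` ({0..T} \<times> (K - M interior_of K))"
  have KM: "K \<subseteq> topspace M" using K by (rule compactin_subset_topspace)
  have "K - M interior_of K = (topspace M - M interior_of K) \<inter> K" using KM by blast
  moreover have "compactin M ((topspace M - M interior_of K) \<inter> K)"
    by (intro closed_Int_compactin K closedin_diff closedin_topspace openin_interior_of)
  ultimately have "compactin M (K - M interior_of K)" by simp
  then have "compactin ?P ({0..T} \<times> (K - M interior_of K))"
    by (simp add: compactin_Times compactin_subtopology)
  then have "compactin M C"
    unfolding C_def by (rule image_compactin[OF _ continuous_map_flow])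
  then have "closedin M C" using Hausdorff by (rule compactin_imp_closedin[rotated])
  then have "openin M (M interior_of K - C)" by (intro openin_diff openin_interior_of)
  \<comment> \<open>Backward invariance: an orbit that starts outside \<open>A\<close> never enters
    it.\<close>
  moreover have "A \<inter> C = {}"
    using flow_in_A_iff KM AK unfolding C_def by fastforce
  with AK have "A \<subseteq> M interior_of K - C" by blast
  moreover have "M interior_of K - C \<subseteq> \<phi> T ` K"
  proof
    fix x assume x: "x \<in> M interior_of K - C"
    show "x \<in> \<phi> T ` K"
    proof (rule ccontr)
      assume "x \<notin> \<phi> T ` K"
      then obtain s y where "s \<in> {0..T}" "y \<in> K - M interior_of K" "\<phi> s y = x"
        using backward_exit[OF no_start K T] x interior_of_subset by (metis DiffD1 subsetD)
      then have "x \<in> C" unfolding C_def by force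
      with x show False by blast
    qed
  qed
  ultimately show thesis by (rule that)
qed

text \<open>A compact subset of a locally compact Hausdorff space need not be a zero set. Here the
  flow supplies countably many neighbourhoods of \<open>A\<close> whose intersection lies in
  \<open>A\<close>.\<close>

lemma attractor_zero_set:
  assumes no_start: "start_points M \<phi> = {}"
  obtains w where "continuous_map X euclideanreal w" and "\<And>x. x \<in> \<D> \<Longrightarrow> 0 \<le> w x"
    and "\<And>x. x \<in> \<D> \<Longrightarrow> w x = 0 \<longleftrightarrow> x \<in> A"
proof -
  have "locally_compact_space X"
    by (rule locally_compact_space_open_subset[OF disjI1[OF Hausdorff] locally_compact openin_domain])
  moreover have "Hausdorff_space X" using Hausdorff by (rule Hausdorff_space_subtopology)
  moreover have "compactin X A" using compact_A A_subset_domain by (simp add: compactin_subtopology)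
  \<comment> \<open>\<open>K\<close> is found inside the domain of attraction, so that attraction is
    uniform on it.\<close>
  ultimately obtain O' K where O': "openin X O'" "A \<subseteq> O'" "O' \<subseteq> K" and K: "compactin X K"
    using locally_compact_space_compact_closed_compact[of X] by meson
  have K: "compactin M K" "K \<subseteq> \<D>" using K by (auto simp: compactin_subtopology)
  have "openin M O'" using O'(1) openin_domain by (rule openin_trans_full)
  with O' have AK: "A \<subseteq> M interior_of K" by (meson interior_of_maximal subset_trans)
  have "\<exists>N. openin M N \<and> A \<subseteq> N \<and> N \<subseteq> \<phi> (real n) ` K" for n :: nat
    by (rule neighbourhood_within_flow_image[OF no_start K(1) _ AK, of "real n"]) auto
  then obtain N where N: "\<And>n::nat. openin M (N n)" "\<And>n. A \<subseteq> N n" "\<And>n. N n \<subseteq> \<phi> (real n) ` K"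
    by metis
  have Inter: "(\<Inter>n. N n) \<subseteq> A"
  proof (rule ccontr)
    assume "\<not> (\<Inter>n. N n) \<subseteq> A"
    then obtain p where p: "\<And>n. p \<in> N n" "p \<notin> A" by blast
    have "p \<in> topspace M" using p(1) N(1) openin_subset by blast
    \<comment> \<open>The complement of \<open>p\<close> is an open neighbourhood of
      \<open>A\<close>, so at late times the image of \<open>K\<close> misses \<open>p\<close>,
      although it contains \<open>N n\<close> and hence \<open>p\<close>.\<close>
    then have "openin M (topspace M - {p})"
      using Hausdorff by (intro openin_diff openin_topspace closedin_Hausdorff_singleton)
    moreover have "A \<subseteq> topspace M - {p}" using A_subset p by blast
    ultimately obtain T where T: "\<And>x t. x \<in> K \<Longrightarrow> t \<ge> T \<Longrightarrow> \<phi> t x \<in> topspace M - {p}"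
      using uniformly_attracted[OF K] by metis
    obtain n :: nat where "T \<le> n" using real_arch_simple by blast
    with T N(3)[of n] p(1)[of n] show False by blast
  qed
  obtain w where "continuous_map M euclideanreal w"
    and "\<And>x. x \<in> topspace M \<Longrightarrow> 0 \<le> w x" and "\<And>x. x \<in> topspace M \<Longrightarrow> w x = 0 \<longleftrightarrow> x \<in> A"
    by (rule zero_set_Inter_neighbourhoods[OF completely_regular compact_A N(1,2) Inter], rule that)
      simp_all
  then show thesis
    using domain_subset by (intro that[of w] continuous_map_from_subtopology) auto
qed

end

theorem mainTheorem1:
  fixes M :: "'a topology" and \<phi> :: "real \<Rightarrow> 'a \<Rightarrow> 'a" and A :: "'a set"
  assumes "semi_dynamical_system M \<phi>"
    and "start_points M \<phi> = {}"
    and "invariant_attractor M \<phi> A"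
  shows "A strong_deformation_retract_of_space (subtopology M (domain_of_attraction M \<phi> A)) \<longleftrightarrow>
         cofibration (subtopology M A) (subtopology M (domain_of_attraction M \<phi> A)) (\<lambda>x. x)"
proof -
  interpret semiflow_attractor M \<phi> A
    using assms(1,3) by unfold_locales
  have "subtopology X A = subtopology M A"
    using A_subset_domain by (simp add: subtopology_subtopology Int_absorb1)
  moreover obtain w where "continuous_map X euclideanreal w" "\<And>x. x \<in> \<D> \<Longrightarrow> 0 \<le> w x"
    "\<And>x. x \<in> \<D> \<Longrightarrow> w x = 0 \<longleftrightarrow> x \<in> A"
    by (rule attractor_zero_set[OF assms(2)], rule that) simp_all
  then have "cofibration (subtopology X A) X (\<lambda>x. x)" if "A strong_deformation_retract_of_space X"
    by (intro strong_deformation_retract_imp_cofibration[OF that, of w]) (simp_all only: topspace_X)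
  ultimately show ?thesis
    using cofibration_imp_strong_deformation_retract by (simp only:) (rule iffI)
qed

end
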